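(* Let $X_1,\dots,X_n$ be dependent random variables sharing an Archimedean copula with generator $\psi_1$, with $X_i\sim LS(\lambda_i,\sigma_i,F)$, $i=1,\dots,n$. Let $Y_1,\dots,Y_n$ be dependent random variables sharing an Archimedean copula with generator $\psi_2$, with $Y_i\sim LS(\mu_i,\sigma_i,G)$, $i=1,\dots,n$. Assume that $\boldsymbol{\lambda},\boldsymbol{\sigma},\boldsymbol{\mu}$ all belong to $\mathcal{D}_+$ (or all belong to $\mathcal{E}_+$). Suppose that $\phi_2\circ\psi_1$ is super-additive, that $\psi_1$ or $\psi_2$ is log-convex, and that either $u\,\tilde r_X(u)$ or $u\,\tilde r_Y(u)$ is decreasing in $u$. Then $$X\geq_{st}Y\ \text{ and }\ \boldsymbol{\lambda}\succeq_w\boldsymbol{\mu}\quad\Longrightarrow\quad X_{n:n}\geq_{st}Y_{n:n}.$$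
   Context: Location-scale family: a random variable follows $LS(\lambda,\sigma,F)$, $\lambda\in\mathbb{R}$, $\sigma>0$, if its distribution function is $x\mapsto F\left(\frac{x-\lambda}{\sigma}\right)$ for $x>\lambda$, where $F$ is a baseline distribution function (so only arguments $u>0$ of the baseline functions matter). $X$ and $Y$ are absolutely continuous random variables with distribution functions $F$ and $G$ and densities $f$ and $g$; their reversed hazard rates are $\tilde r_X=f/F$ and $\tilde r_Y=g/G$. $\boldsymbol{\lambda}=(\lambda_1,\dots,\lambda_n)$, $\boldsymbol{\mu}=(\mu_1,\dots,\mu_n)$, $\boldsymbol{\sigma}=(\sigma_1,\dots,\sigma_n)$. Copulas: a generator is $\psi:[0,\infty]\to[0,1]$ with $\psi(0)=1$, $\psi(\infty)=0$ that is $n$-monotone, i.e. $(-1)^k\psi^{(k)}\ge 0$ for $k=0,\dots,n-2$ and $(-1)^{n-2}\psi^{(n-2)}$ is decreasing and convex; the Archimedean copula is $C_\psi(u_1,\dots,u_n)=\psi\left(\sum_{k=1}^n\psi^{-1}(u_k)\right)$. Write $\phi_i=\psi_i^{-1}$ (right-continuous inverse). The $X_k$ have joint distribution function $P(X_1\le x_1,\dots,X_n\le x_n)=\psi_1\left(\sum_k\phi_1(P(X_k\le x_k))\right)$, and similarly for the $Y_k$ with $\psi_2,\phi_2$; thus for $t>\max_k\lambda_k$ the distribution function of $X_{n:n}$ is $\psi_1\left[\sum_{k=1}^n\phi_1\left\{F\left(\frac{t-\lambda_k}{\sigma_k}\right)\right\}\right]$, and for $t>\max_k\mu_k$ that of $Y_{n:n}$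 is $\psi_2\left[\sum_{k=1}^n\phi_2\left\{G\left(\frac{t-\mu_k}{\sigma_k}\right)\right\}\right]$. A function $f$ is super-additive if $f(x+y)\ge f(x)+f(y)$ for all $x,y$ in its domain. $X_{n:n}=\max_i X_i$, $Y_{n:n}=\max_i Y_i$. $U\geq_{st}V$ means $P(U\le t)\le P(V\le t)$ for all $t$. $\mathcal{D}_+=\{\mathbf{x}: x_1\ge x_2\ge\dots\ge x_n>0\}$, $\mathcal{E}_+=\{\mathbf{x}: 0<x_1\le x_2\le\dots\le x_n\}$. With $x_{(1)}\le\dots\le x_{(n)}$ the increasing arrangement, $\mathbf{x}\succeq_{w}\mathbf{y}$ means $\sum_{i=j}^n x_{(i)}\ge\sum_{i=j}^n y_{(i)}$ for $j=1,\dots,n$. *)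

theory Defs
  imports "HOL-Probability.Probability"
begin

section \<open>Archimedean generators and copulas\<close>

text \<open>Vectors of length \<open>n\<close> are functions on \<open>nat\<close> of which only the
  values at \<open>1, \<dots>, n\<close> are used. Generators live on \<open>[0,\<infinity>]\<close>, i.e. on
  \<^typ>\<open>ennreal\<close>, so that a non-strict generator and a strict one (whose inverse is
  infinite at 0) are treated alike.\<close>

text \<open>Meant for \<open>n \<ge> 2\<close> (the subtraction truncates below that). Derivatives and signs are
  taken on the open half-line.\<close>

definition n_monotone :: "nat \<Rightarrow> (real \<Rightarrow> real) \<Rightarrow> bool" where
  "n_monotone n g \<longleftrightarrow>
     (\<forall>k<n - 2. \<forall>x>0. (deriv ^^ k) g differentiable at x) \<and>
     (\<forall>k\<le>n - 2. \<forall>x>0. 0 \<le> (-1) ^ k * (deriv ^^ k) g x) \<and>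
     antimono_on {0<..} (\<lambda>x. (-1) ^ (n - 2) * (deriv ^^ (n - 2)) g x) \<and>
     convex_on {0<..} (\<lambda>x. (-1) ^ (n - 2) * (deriv ^^ (n - 2)) g x)"

text \<open>Continuity on the compact \<open>[0,\<infinity>]\<close> is the usual convention: \<open>\<psi>\<close> is continuous
  on \<open>[0,\<infinity>)\<close>, and \<open>\<psi>(\<infinity>) = 0\<close> is the limit at infinity.\<close>

definition generator :: "nat \<Rightarrow> (ennreal \<Rightarrow> real) \<Rightarrow> bool" where
  "generator n \<psi> \<longleftrightarrow>
     (\<forall>x. 0 \<le> \<psi> x \<and> \<psi> x \<le> 1) \<and> \<psi> 0 = 1 \<and> \<psi> \<infinity> = 0 \<and>
     continuous_on UNIV \<psi> \<and> n_monotone n (\<lambda>x. \<psi> (ennreal x))"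

text \<open>The right-continuous inverse; in particular its value at 0 is the first zero of
  \<open>\<psi>\<close>, which is \<open>\<infinity>\<close> for a strict generator.\<close>

definition gen_inv :: "(ennreal \<Rightarrow> real) \<Rightarrow> real \<Rightarrow> ennreal" where
  "gen_inv \<psi> u = Inf {x. \<psi> x \<le> u}"

definition archimedean_copula :: "nat \<Rightarrow> (ennreal \<Rightarrow> real) \<Rightarrow> (nat \<Rightarrow> real) \<Rightarrow> real" where
  "archimedean_copula n \<psi> u = \<psi> (\<Sum>k=1..n. gen_inv \<psi> (u k))"

definition super_additive :: "(ennreal \<Rightarrow> ennreal) \<Rightarrow> bool" where
  "super_additive h \<longleftrightarrow> (\<forall>x y. h x + h y \<le> h (x + y))"

text \<open>Positivity is stated because \<open>ln 0\<close> has the value \<open>0\<close> here.\<close>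

definition log_convex :: "(ennreal \<Rightarrow> real) \<Rightarrow> bool" where
  "log_convex \<psi> \<longleftrightarrow>
     (\<forall>x\<ge>0. 0 < \<psi> (ennreal x)) \<and> convex_on {0..} (\<lambda>x. ln (\<psi> (ennreal x)))"

section \<open>Random variables\<close>

definition cdf_of :: "'a measure \<Rightarrow> ('a \<Rightarrow> real) \<Rightarrow> real \<Rightarrow> real" where
  "cdf_of M U = cdf (distr M borel U)"

definition has_density :: "'a measure \<Rightarrow> ('a \<Rightarrow> real) \<Rightarrow> (real \<Rightarrow> real) \<Rightarrow> bool" where
  "has_density M U f \<longleftrightarrow> (\<forall>u. 0 \<le> f u) \<and> distributed M lborel U (\<lambda>u. ennreal (f u))"

definition st_ge :: "'a measure \<Rightarrow> ('a \<Rightarrow> real) \<Rightarrow> 'b measure \<Rightarrow> ('b \<Rightarrow> real) \<Rightarrow> bool" where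
  "st_ge M U N V \<longleftrightarrow> (\<forall>t. cdf_of M U t \<le> cdf_of N V t)"

text \<open>The law is carried by \<open>[l,\<infinity>)\<close>. The value of the distribution function at \<open>l\<close>
  itself is determined by right-continuity; it is 0 when the baseline satisfies \<open>F 0 = 0\<close>.\<close>

definition location_scale ::
    "'a measure \<Rightarrow> ('a \<Rightarrow> real) \<Rightarrow> real \<Rightarrow> real \<Rightarrow> (real \<Rightarrow> real) \<Rightarrow> bool" where
  "location_scale M U l s F \<longleftrightarrow>
     U \<in> borel_measurable M \<and>
     (\<forall>x>l. cdf_of M U x = F ((x - l) / s)) \<and>
     (\<forall>x<l. cdf_of M U x = 0)"

definition shares_archimedean_copula ::
    "'a measure \<Rightarrow> nat \<Rightarrow> (nat \<Rightarrow> 'a \<Rightarrow> real) \<Rightarrow> (ennreal \<Rightarrow> real) \<Rightarrow> bool" where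
  "shares_archimedean_copula M n X \<psi> \<longleftrightarrow>
     (\<forall>x :: nat \<Rightarrow> real.
        measure M {\<omega> \<in> space M. \<forall>k\<in>{1..n}. X k \<omega> \<le> x k} =
        archimedean_copula n \<psi> (\<lambda>k. cdf_of M (X k) (x k)))"

definition max_stat :: "nat \<Rightarrow> (nat \<Rightarrow> 'a \<Rightarrow> real) \<Rightarrow> 'a \<Rightarrow> real" where
  "max_stat n X \<omega> = Max ((\<lambda>k. X k \<omega>) ` {1..n})"

definition rev_hazard :: "(real \<Rightarrow> real) \<Rightarrow> (real \<Rightarrow> real) \<Rightarrow> real \<Rightarrow> real" where
  "rev_hazard f F u = f u / F u"

text \<open>The quotient is only meaningful where \<open>F\<close> is positive, and only positive
  arguments of the baseline matter.\<close>

definition u_rev_hazard_decreasing :: "(real \<Rightarrow> real) \<Rightarrow> (real \<Rightarrow> real) \<Rightarrow> bool" where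
  "u_rev_hazard_decreasing f F \<longleftrightarrow>
     antimono_on {u. 0 < u \<and> 0 < F u} (\<lambda>u. u * rev_hazard f F u)"

section \<open>Ordered cones and weak submajorization\<close>

definition D_plus :: "nat \<Rightarrow> (nat \<Rightarrow> real) set" where
  "D_plus n = {x. (\<forall>i\<in>{1..n}. \<forall>j\<in>{1..n}. i \<le> j \<longrightarrow> x j \<le> x i) \<and> (\<forall>i\<in>{1..n}. 0 < x i)}"

definition E_plus :: "nat \<Rightarrow> (nat \<Rightarrow> real) set" where
  "E_plus n = {x. (\<forall>i\<in>{1..n}. \<forall>j\<in>{1..n}. i \<le> j \<longrightarrow> x i \<le> x j) \<and> (\<forall>i\<in>{1..n}. 0 < x i)}"

definition increasing_arrangement :: "nat \<Rightarrow> (nat \<Rightarrow> real) \<Rightarrow> nat \<Rightarrow> real" where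
  "increasing_arrangement n x i = sort (map x [1..<Suc n]) ! (i - 1)"

definition weakly_submajorizes :: "nat \<Rightarrow> (nat \<Rightarrow> real) \<Rightarrow> (nat \<Rightarrow> real) \<Rightarrow> bool" where
  "weakly_submajorizes n x y \<longleftrightarrow>
     (\<forall>j\<in>{1..n}. (\<Sum>i=j..n. increasing_arrangement n y i)
                 \<le> (\<Sum>i=j..n. increasing_arrangement n x i))"

end

theory Submission
  imports Defs
begin

text \<open>Write \<open>\<phi> = gen_inv \<psi>\<close>. Beyond all locations the distribution function of a maximum is
  \<open>\<psi> (\<Sum>k. \<phi> (H ((t - l k) / \<sigma> k)))\<close>, and passing from the \<open>Xs\<close> to the \<open>Ys\<close> changes three things,
  each of which can only increase this value. Changing the generator is governed by
  super-additivity (\<open>archimedean_copula_le_if_super_additive\<close>), changing the baseline by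
  monotonicity of the copula (\<open>archimedean_copula_mono\<close>), and changing the locations by
  \<open>copula_location_comparison\<close>. The first two steps are possible at any stage, so the last one can be
  made with whichever generator is log-convex and whichever baseline has a decreasing
  \<open>u * rev_hazard\<close>.

  The comparison of locations usually goes through Schur-convexity and partial derivatives. Here it
  rests on a substitution instead: in the variable \<open>s = ln ((t - l k) / \<sigma> k)\<close> all summands are values
  of one function \<open>K s = \<phi> (H (exp s))\<close>. The function \<open>ln (H (exp s))\<close> is concave because its slope
  is \<open>u * rev_hazard\<close> at \<open>u = exp s\<close> (\<open>ln_cdf_supporting_line\<close>), and then log-convexity of \<open>\<psi>\<close>
  makes \<open>K\<close> convex (\<open>convex_on_gen_inv_comp\<close>). Subgradients of the decreasing convex \<open>K\<close> bound the change
  of the sum from below by a weighted sum of the differences of the locations. The common ordering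
  of locations and scales makes the weights monotone, so Abel summation turns weak submajorization
  into the required sign (\<open>sum_convex_location_comparison\<close>).

  At arguments that are not beyond all locations \<open>lam\<close>, the maximum of the \<open>Xs\<close> has distribution
  function 0, except at the largest location, which is reached by right-continuity.\<close>

section \<open>Generators and their right-continuous inverses\<close>

text \<open>On \<open>(0,\<infinity>)\<close> the monotonicity is part of the definition when \<open>n = 2\<close> and is the sign of
  the first derivative when \<open>n > 2\<close>; the two endpoints are the extreme values 1 and 0.\<close>

lemma generator_antimono:
  assumes n: "2 \<le> n" and gen: "generator n \<psi>"
  shows "antimono \<psi>"
proof -
  define g where "g = (\<lambda>x. \<psi> (ennreal x))"
  have mon: "n_monotone n g" and b: "\<And>x. 0 \<le> \<psi> x \<and> \<psi> x \<le> 1" and "\<psi> 0 = 1" "\<psi> \<infinity> = 0"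
    using gen by (auto simp: generator_def g_def)
  have pos: "g y \<le> g x" if "0 < x" "x \<le> y" for x y
  proof (cases "n = 2")
    case True
    have "antimono_on {0<..} g"
      using mon by (simp add: n_monotone_def True)
    then show ?thesis using that by (auto simp: monotone_on_def)
  next
    case False
    then have "0 < n - 2" "1 \<le> n - 2" using n by auto
    then have d: "\<forall>x>0. (deriv ^^ 0) g differentiable at x"
      and s: "\<forall>x>0. 0 \<le> (-1) ^ 1 * (deriv ^^ 1) g x"
      using mon unfolding n_monotone_def by blast+
    have "(g has_real_derivative deriv g z) (at z)" "deriv g z \<le> 0" if "0 < z" for z
      using d s that by (auto simp: real_differentiable_def DERIV_deriv_iff_real_differentiable)
    then show ?thesis
      using that by (intro DERIV_nonpos_imp_nonincreasing[of x y g]) (auto, meson less_le_trans)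
  qed
  show ?thesis
  proof (rule antimonoI)
    fix x y :: ennreal assume xy: "x \<le> y"
    consider "x = 0" | "y = \<infinity>" | "0 < x" "y < \<infinity>"
      by (metis infinity_ennreal_def not_gr_zero top.not_eq_extremum)
    then show "\<psi> y \<le> \<psi> x"
    proof cases
      case 3
      with xy have "x < \<infinity>" by auto
      have x: "ennreal (enn2real x) = x" and y: "ennreal (enn2real y) = y"
        using 3 \<open>x < \<infinity>\<close> by auto
      have "enn2real x \<le> enn2real y" using xy 3 by (simp add: enn2real_mono)
      moreover have "0 < enn2real x" using 3 \<open>x < \<infinity>\<close> by (simp add: enn2real_positive_iff)
      ultimately show ?thesis using pos[of "enn2real x" "enn2real y"] by (simp add: g_def x y)
    qed (use b \<open>\<psi> 0 = 1\<close> \<open>\<psi> \<infinity> = 0\<close> in auto)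
  qed
qed

lemma gen_inv_le:
  "\<psi> x \<le> u \<Longrightarrow> gen_inv \<psi> u \<le> x"
  unfolding gen_inv_def by (intro Inf_lower) auto

lemma gen_inv_antimono:
  assumes "u \<le> v"
  shows "gen_inv \<psi> v \<le> gen_inv \<psi> u"
  unfolding gen_inv_def using assms by (intro Inf_superset_mono) auto

text \<open>Continuity on the compact \<open>[0,\<infinity>]\<close> serves twice: the intermediate value theorem makes every
  level \<open>u\<close> attained, and the infimum of the closed set \<open>{x. \<psi> x \<le> u}\<close> belongs to it.\<close>

lemma generator_gen_inv:
  assumes n: "2 \<le> n" and gen: "generator n \<psi>" and u: "0 \<le> u" "u \<le> 1"
  shows "\<psi> (gen_inv \<psi> u) = u"
proof -
  have c: "continuous_on UNIV \<psi>" and e: "\<psi> 0 = 1" "\<psi> \<infinity> = 0"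
    using gen by (auto simp: generator_def)
  have "\<exists>x. 0 \<le> x \<and> x \<le> \<infinity> \<and> \<psi> x = u"
    by (rule IVT2') (use e u continuous_on_subset[OF c] in auto)
  then obtain x where x: "\<psi> x = u" by auto
  have cl: "closed {x. \<psi> x \<le> u}"
    by (intro closed_Collect_le c continuous_on_const)
  have "gen_inv \<psi> u \<in> {x. \<psi> x \<le> u}"
    unfolding gen_inv_def using x by (intro closed_contains_Inf_cl cl) auto
  moreover have "gen_inv \<psi> u \<le> x"
    using x by (intro gen_inv_le) simp
  then have "u \<le> \<psi> (gen_inv \<psi> u)"
    using generator_antimono[OF n gen] x by (auto dest: antimonoD)
  ultimately show ?thesis by auto
qed

section \<open>Monotonicity and symmetry of Archimedean copulas\<close>

lemma archimedean_copula_mono: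
  assumes n: "2 \<le> n" and gen: "generator n \<psi>"
    and uv: "\<And>k. k \<in> {1..n} \<Longrightarrow> u k \<le> v k"
  shows "archimedean_copula n \<psi> u \<le> archimedean_copula n \<psi> v"
  unfolding archimedean_copula_def
  by (intro antimonoD[OF generator_antimono[OF n gen]] sum_mono gen_inv_antimono uv)

lemma archimedean_copula_rev:
  "archimedean_copula n \<psi> (\<lambda>k. u (n + 1 - k)) = archimedean_copula n \<psi> u"
  unfolding archimedean_copula_def
  using sum.atLeastAtMost_rev[of "\<lambda>k. gen_inv \<psi> (u k)" 1 n] by (simp add: add.commute)

text \<open>With \<open>x k = gen_inv \<psi>\<^sub>1 (u k)\<close>, super-additivity compares \<open>\<Sum>k. gen_inv \<psi>\<^sub>2 (u k)\<close> with
  \<open>gen_inv \<psi>\<^sub>2 (\<psi>\<^sub>1 (\<Sum>k. x k))\<close>; the decreasing \<open>\<psi>\<^sub>2\<close> turns this into the comparison of the two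
  copulas.\<close>

lemma archimedean_copula_le_if_super_additive:
  assumes n: "2 \<le> n" and gen1: "generator n \<psi>\<^sub>1" and gen2: "generator n \<psi>\<^sub>2"
    and super: "super_additive (gen_inv \<psi>\<^sub>2 \<circ> \<psi>\<^sub>1)"
    and u: "\<And>k. k \<in> {1..n} \<Longrightarrow> 0 \<le> u k \<and> u k \<le> 1"
  shows "archimedean_copula n \<psi>\<^sub>1 u \<le> archimedean_copula n \<psi>\<^sub>2 u"
proof -
  define h where "h = gen_inv \<psi>\<^sub>2 \<circ> \<psi>\<^sub>1"
  define S where "S = (\<Sum>k=1..n. gen_inv \<psi>\<^sub>1 (u k))"
  have b: "0 \<le> \<psi>\<^sub>1 x \<and> \<psi>\<^sub>1 x \<le> 1" for x
    using gen1 by (simp add: generator_def)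
  have sum_h: "(\<Sum>k\<in>A. h (x k)) \<le> h (\<Sum>k\<in>A. x k)" if "finite A" for A :: "nat set" and x
    using that
  proof induction
    case empty
    have "h 0 = 0"
      using gen1 gen_inv_le[of \<psi>\<^sub>2 0 1] gen2 by (simp add: h_def generator_def)
    then show ?case by simp
  next
    case (insert a A)
    have "h (x a) + (\<Sum>k\<in>A. h (x k)) \<le> h (x a) + h (\<Sum>k\<in>A. x k)"
      using insert.IH by (rule add_left_mono)
    also have "\<dots> \<le> h (x a + (\<Sum>k\<in>A. x k))"
      using super by (simp add: super_additive_def h_def)
    finally show ?case using insert.hyps by simp
  qed
  have "(\<Sum>k=1..n. gen_inv \<psi>\<^sub>2 (u k)) = (\<Sum>k=1..n. h (gen_inv \<psi>\<^sub>1 (u k)))"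
    by (intro sum.cong) (simp_all add: h_def generator_gen_inv[OF n gen1] u)
  also have "\<dots> \<le> h S"
    unfolding S_def by (rule sum_h) simp
  finally have "\<psi>\<^sub>2 (h S) \<le> archimedean_copula n \<psi>\<^sub>2 u"
    unfolding archimedean_copula_def by (rule antimonoD[OF generator_antimono[OF n gen2]])
  moreover have "\<psi>\<^sub>2 (h S) = \<psi>\<^sub>1 S"
    using b by (simp add: h_def generator_gen_inv[OF n gen2])
  ultimately show ?thesis
    by (simp add: archimedean_copula_def S_def)
qed

section \<open>Growth of a distribution function with a density\<close>

lemma nn_integral_density_eq_cdf_diff:
  assumes M: "prob_space M" and h: "has_density M U h" and ab: "a \<le> b"
  shows "(\<integral>\<^sup>+x. ennreal (h x) * indicator {a..b} x \<partial>lborel) = ennreal (cdf_of M U b - cdf_of M U a)"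
proof -
  have dist: "distributed M lborel U (\<lambda>u. ennreal (h u))"
    using h by (simp add: has_density_def)
  have U: "U \<in> borel_measurable M" and hm: "(\<lambda>u. ennreal (h u)) \<in> borel_measurable lborel"
    using dist by (auto simp: distributed_def)
  interpret real_distribution "distr M borel U"
    using prob_space.real_distribution_distr[OF M U] .
  have "cdf_of M U b - cdf_of M U a = measure (distr M borel U) {a<..b}"
    using ab cdf_diff_eq[of a b] by (cases "a = b") (auto simp: cdf_of_def)
  then have "ennreal (cdf_of M U b - cdf_of M U a) = emeasure (distr M borel U) {a<..b}"
    by (simp add: emeasure_eq_measure)
  also have "\<dots> = emeasure M (U -` {a<..b} \<inter> space M)"
    using U by (simp add: emeasure_distr)
  also have "\<dots> = (\<integral>\<^sup>+x. ennreal (h x) * indicator {a<..b} x \<partial>lborel)"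
    by (rule distributed_emeasure[OF dist]) simp
  also have "\<dots> = (\<integral>\<^sup>+x. ennreal (h x) * indicator {a..b} x \<partial>lborel)"
    by (rule nn_integral_cong_AE, use AE_lborel_singleton[of a] in eventually_elim)
       (auto simp: indicator_def)
  finally show ?thesis by simp
qed

lemma isCont_cdf_of:
  assumes M: "prob_space M" and h: "has_density M U h"
  shows "isCont (cdf_of M U) x"
proof -
  have dist: "distributed M lborel U (\<lambda>u. ennreal (h u))"
    using h by (simp add: has_density_def)
  have U: "U \<in> borel_measurable M"
    using dist by (auto simp: distributed_def)
  interpret real_distribution "distr M borel U"
    using prob_space.real_distribution_distr[OF M U] .
  have "emeasure (distr M borel U) {x} = emeasure M (U -` {x} \<inter> space M)"
    using U by (simp add: emeasure_distr)
  also have "\<dots> = (\<integral>\<^sup>+x'. ennreal (h x') * indicator {x} x' \<partial>lborel)"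
    by (rule distributed_emeasure[OF dist]) simp
  also have "\<dots> = (\<integral>\<^sup>+(x'::real). 0 \<partial>lborel)"
    by (rule nn_integral_cong_AE, use AE_lborel_singleton[of x] in eventually_elim)
       (auto simp: indicator_def)
  finally have "measure (distr M borel U) {x} = 0"
    by (simp add: measure_def)
  then show ?thesis
    using isCont_cdf by (simp add: cdf_of_def)
qed

lemma cdf_of_bounds:
  assumes M: "prob_space M" and U: "U \<in> borel_measurable M"
  shows "0 \<le> cdf_of M U x" "cdf_of M U x \<le> 1" "mono (cdf_of M U)"
proof -
  interpret real_distribution "distr M borel U"
    using prob_space.real_distribution_distr[OF M U] .
  show "0 \<le> cdf_of M U x" "cdf_of M U x \<le> 1" "mono (cdf_of M U)"
    using cdf_nonneg cdf_bounded_prob cdf_nondecreasing by (auto simp: cdf_of_def mono_def)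
qed

lemma nn_integral_inverse_eq_ln:
  assumes "0 < a" "a \<le> b" "0 \<le> c"
  shows "(\<integral>\<^sup>+x. ennreal (c / x) * indicator {a..b} x \<partial>lborel) = ennreal (c * (ln b - ln a))"
  using assms
  by (subst nn_integral_FTC_Icc[where F = "\<lambda>x. c * ln x"])
     (auto intro!: derivative_eq_intros simp: algebra_simps has_real_derivative_iff_has_vector_derivative[symmetric])

lemma cdf_increment_le:
  assumes M: "prob_space M" and h: "has_density M U h"
    and ab: "0 < a" "a \<le> b" and c: "0 \<le> c"
    and le: "\<And>x. a \<le> x \<Longrightarrow> x \<le> b \<Longrightarrow> h x \<le> c / x"
  shows "cdf_of M U b - cdf_of M U a \<le> c * (ln b - ln a)"
proof -
  have "ennreal (cdf_of M U b - cdf_of M U a) \<le> ennreal (c * (ln b - ln a))"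
    unfolding nn_integral_density_eq_cdf_diff[OF M h ab(2), symmetric]
      nn_integral_inverse_eq_ln[OF ab c, symmetric]
    using le by (intro nn_integral_mono) (auto simp: indicator_def intro!: ennreal_leI)
  then show ?thesis
    using ab c by (subst (asm) ennreal_le_iff) auto
qed

lemma cdf_increment_ge:
  assumes M: "prob_space M" and h: "has_density M U h"
    and ab: "0 < a" "a \<le> b" and c: "0 \<le> c"
    and le: "\<And>x. a \<le> x \<Longrightarrow> x \<le> b \<Longrightarrow> c / x \<le> h x"
  shows "c * (ln b - ln a) \<le> cdf_of M U b - cdf_of M U a"
proof -
  have U: "U \<in> borel_measurable M" using h by (auto simp: has_density_def distributed_def)
  have "ennreal (c * (ln b - ln a)) \<le> ennreal (cdf_of M U b - cdf_of M U a)"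
    unfolding nn_integral_density_eq_cdf_diff[OF M h ab(2), symmetric]
      nn_integral_inverse_eq_ln[OF ab c, symmetric]
    using le by (intro nn_integral_mono) (auto simp: indicator_def intro!: ennreal_leI)
  then show ?thesis
    using cdf_of_bounds(3)[OF M U] ab by (subst (asm) ennreal_le_iff) (auto dest: monoD)
qed

text \<open>The density need not be continuous, so \<open>ln H\<close> cannot be differentiated pointwise. It is
  compared with \<open>L\<close> over short intervals instead. There \<open>1 - 1/x \<le> ln x \<le> x - 1\<close> bounds the
  increment of \<open>ln H\<close> by relative increments of \<open>H\<close>, and continuity keeps \<open>H p / H q\<close> above any
  factor \<open>z < 1\<close>. Both comparisons are additive in the interval, so they pass from short intervals
  to \<open>[a,b]\<close> by Bolzano's subdivision argument, and then \<open>z\<close> tends to 1.\<close>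

lemma ln_increment_between:
  fixes H L :: "real \<Rightarrow> real"
  assumes ab: "a \<le> b" and mono: "mono H" and pos: "0 < H a" and cont: "\<And>x. isCont H x"
    and L: "mono_on {a..b} L"
  shows ln_increment_le:
    "(\<And>p q. a \<le> p \<Longrightarrow> p \<le> q \<Longrightarrow> q \<le> b \<Longrightarrow> H q - H p \<le> H q * (L q - L p)) \<Longrightarrow>
      ln (H b) - ln (H a) \<le> L b - L a"
    and ln_increment_ge:
    "(\<And>p q. a \<le> p \<Longrightarrow> p \<le> q \<Longrightarrow> q \<le> b \<Longrightarrow> H p * (L q - L p) \<le> H q - H p) \<Longrightarrow>
      L b - L a \<le> ln (H b) - ln (H a)"
proof -
  have H_pos: "0 < H x" if "a \<le> x" for x
    using pos monoD[OF mono that] by simp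
  have ratio: "\<exists>d>0. \<forall>p q. p \<le> x \<and> x \<le> q \<and> q - p < d \<longrightarrow> z * H q \<le> H p"
    if x: "a \<le> x" and z: "0 < z" "z < 1" for x z :: real
  proof -
    define e where "e = (1 - z) * H x / 2"
    have "0 < e" using z H_pos[OF x] by (simp add: e_def)
    then obtain d where d: "0 < d" "\<And>y. dist y x < d \<Longrightarrow> dist (H y) (H x) < e"
      using cont[of x] unfolding continuous_at_eps_delta by blast
    have "z * H q \<le> H p" if "p \<le> x" "x \<le> q" "q - p < d" for p q
    proof -
      have "H q \<le> H x + e" "H x - e \<le> H p"
        using d(2)[of p] d(2)[of q] that by (auto simp: dist_real_def)
      moreover have "z * (H x + e) \<le> H x - e"
      proof -
        have "(1 + z) * e \<le> 2 * e" using z \<open>0 < e\<close> by simp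
        moreover have "2 * e = (1 - z) * H x" by (simp add: e_def)
        ultimately show ?thesis by (simp add: algebra_simps)
      qed
      ultimately show ?thesis
        using z mult_left_mono[of "H q" "H x + e" z] by linarith
    qed
    then show ?thesis using d(1) by blast
  qed
  have ln_upper: "ln (H q) - ln (H p) \<le> (H q - H p) / H p"
    and ln_lower: "(H q - H p) / H q \<le> ln (H q) - ln (H p)" if "a \<le> p" "p \<le> q" for p q
  proof -
    have *: "0 < H p" "0 < H q" using H_pos that by auto
    show "ln (H q) - ln (H p) \<le> (H q - H p) / H p"
      using ln_le_minus_one[of "H q / H p"] * by (simp add: ln_div diff_divide_distrib)
    show "(H q - H p) / H q \<le> ln (H q) - ln (H p)"
      using ln_le_minus_one[of "H p / H q"] * by (simp add: ln_div diff_divide_distrib)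
  qed
  show "ln (H b) - ln (H a) \<le> L b - L a"
    if inc: "\<And>p q. a \<le> p \<Longrightarrow> p \<le> q \<Longrightarrow> q \<le> b \<Longrightarrow> H q - H p \<le> H q * (L q - L p)"
  proof (rule field_le_mult_one_interval)
    fix z :: real assume z: "0 < z" "z < 1"
    define P where "P p q \<longleftrightarrow> (a \<le> p \<longrightarrow> q \<le> b \<longrightarrow> z * (ln (H q) - ln (H p)) \<le> L q - L p)" for p q
    have "P a b"
      using ab
    proof (induction rule: Bolzano)
      case (trans p q r)
      then show ?case by (auto simp: P_def algebra_simps)
    next
      case (local x)
      obtain d where d: "d > 0" "\<And>p q. p \<le> x \<Longrightarrow> x \<le> q \<Longrightarrow> q - p < d \<Longrightarrow> z * H q \<le> H p"
        using ratio[OF \<open>a \<le> x\<close> z] by blast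
      have "z * (ln (H q) - ln (H p)) \<le> L q - L p"
        if pq: "p \<le> x" "x \<le> q" "q - p < d" "a \<le> p" "q \<le> b" for p q
      proof -
        have "0 < H p" "0 \<le> L q - L p"
          using H_pos pq mono_onD[OF L, of p q] by auto
        have "ln (H q) - ln (H p) \<le> (H q - H p) / H p"
          using ln_upper pq by auto
        also have "\<dots> \<le> H q * (L q - L p) / H p"
          using inc[of p q] pq \<open>0 < H p\<close> by (simp add: divide_right_mono)
        finally have "z * (ln (H q) - ln (H p)) \<le> z * (H q * (L q - L p) / H p)"
          using z by (intro mult_left_mono) auto
        also have "\<dots> = (z * H q) * (L q - L p) / H p" by simp
        also have "\<dots> \<le> H p * (L q - L p) / H p"
          using d(2)[of p q] pq \<open>0 < H p\<close> \<open>0 \<le> L q - L p\<close>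
          by (intro divide_right_mono mult_right_mono) auto
        finally show ?thesis using \<open>0 < H p\<close> by simp
      qed
      then show ?case using d(1) by (auto simp: P_def)
    qed
    then show "z * (ln (H b) - ln (H a)) \<le> L b - L a" by (simp add: P_def)
  qed
  show "L b - L a \<le> ln (H b) - ln (H a)"
    if inc: "\<And>p q. a \<le> p \<Longrightarrow> p \<le> q \<Longrightarrow> q \<le> b \<Longrightarrow> H p * (L q - L p) \<le> H q - H p"
  proof (rule field_le_mult_one_interval)
    fix z :: real assume z: "0 < z" "z < 1"
    define P where "P p q \<longleftrightarrow> (a \<le> p \<longrightarrow> q \<le> b \<longrightarrow> z * (L q - L p) \<le> ln (H q) - ln (H p))" for p q
    have "P a b"
      using ab
    proof (induction rule: Bolzano)
      case (trans p q r)
      then show ?case by (auto simp: P_def algebra_simps)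
    next
      case (local x)
      obtain d where d: "d > 0" "\<And>p q. p \<le> x \<Longrightarrow> x \<le> q \<Longrightarrow> q - p < d \<Longrightarrow> z * H q \<le> H p"
        using ratio[OF \<open>a \<le> x\<close> z] by blast
      have "z * (L q - L p) \<le> ln (H q) - ln (H p)"
        if pq: "p \<le> x" "x \<le> q" "q - p < d" "a \<le> p" "q \<le> b" for p q
      proof -
        have "0 < H q" "0 \<le> L q - L p"
          using H_pos pq mono_onD[OF L, of p q] by auto
        have "z * (L q - L p) = (z * H q) * (L q - L p) / H q"
          using \<open>0 < H q\<close> by simp
        also have "\<dots> \<le> H p * (L q - L p) / H q"
          using d(2)[of p q] pq \<open>0 < H q\<close> \<open>0 \<le> L q - L p\<close>
          by (intro divide_right_mono mult_right_mono) auto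
        also have "\<dots> \<le> (H q - H p) / H q"
          using inc[of p q] pq \<open>0 < H q\<close> by (simp add: divide_right_mono)
        also have "\<dots> \<le> ln (H q) - ln (H p)"
          using ln_lower pq by auto
        finally show ?thesis .
      qed
      then show ?case using d(1) by (auto simp: P_def)
    qed
    then show "z * (L b - L a) \<le> ln (H b) - ln (H a)" by (simp add: P_def)
  qed
qed

text \<open>As a function of \<open>s = ln v\<close>, the logarithm of the distribution function formally has the
  derivative \<open>v * rev_hazard h H v\<close> with \<open>v = exp s\<close>. This is decreasing, so the line through a point with that
  slope lies above the graph on both sides of the point.\<close>

lemma ln_cdf_supporting_line:
  assumes M: "prob_space M" and h: "has_density M U h"
    and dec: "u_rev_hazard_decreasing h (cdf_of M U)"
    and x: "0 < x" "0 < cdf_of M U x" and y: "0 < y" "0 < cdf_of M U y"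
  shows "ln (cdf_of M U y)
    \<le> ln (cdf_of M U x) + x * rev_hazard h (cdf_of M U) x * (ln y - ln x)"
proof -
  define H where "H = cdf_of M U"
  define c where "c = x * rev_hazard h H x"
  have U: "U \<in> borel_measurable M" and h0: "\<And>u. 0 \<le> h u"
    using h by (auto simp: has_density_def distributed_def)
  have mono: "mono H" and H0: "\<And>u. 0 \<le> H u"
    using cdf_of_bounds[OF M U] by (auto simp: H_def)
  have cont: "\<And>u. isCont H u" using isCont_cdf_of[OF M h] by (simp add: H_def)
  have c: "0 \<le> c" using x h0 by (simp add: c_def rev_hazard_def H_def)
  have pos: "0 < H x" "0 < H y" using x y by (auto simp: H_def)
  \<comment> \<open>Right of \<open>x\<close> the slope \<open>c\<close> bounds \<open>v * h v / H v\<close> from above, left of \<open>x\<close> from below.\<close>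
  have right: "h v \<le> c * H v / v" if "x \<le> v" for v
  proof -
    have v: "0 < H v" "0 < v" using monoD[OF mono that] pos x that by auto
    then have "v * (h v / H v) \<le> c"
      using dec x that by (auto simp: u_rev_hazard_decreasing_def monotone_on_def c_def H_def rev_hazard_def)
    then show ?thesis using v by (simp add: field_simps)
  qed
  have left: "c * H v / v \<le> h v" if "0 < v" "0 < H v" "v \<le> x" for v
  proof -
    have "c \<le> v * (h v / H v)"
      using dec x that by (auto simp: u_rev_hazard_decreasing_def monotone_on_def c_def H_def rev_hazard_def)
    then show ?thesis using that by (simp add: field_simps)
  qed
  have ln_mono: "mono_on {a..b} (\<lambda>v. c * ln v)" if "0 < a" for a b
    using c that by (auto intro!: mono_onI mult_left_mono)
  have "ln (H y) \<le> ln (H x) + c * (ln y - ln x)"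
  proof (cases "x \<le> y")
    case True
    have "ln (H y) - ln (H x) \<le> c * ln y - c * ln x"
    proof (rule ln_increment_le[OF True mono pos(1) cont ln_mono[OF x(1)]])
      fix p q assume pq: "x \<le> p" "p \<le> q" "q \<le> y"
      have "h v \<le> c * H q / v" if "p \<le> v" "v \<le> q" for v
      proof -
        have "h v \<le> c * H v / v" using right that pq by auto
        also have "\<dots> \<le> c * H q / v"
          using monoD[OF mono that(2)] that pq x c by (intro divide_right_mono mult_left_mono) auto
        finally show ?thesis .
      qed
      then have "H q - H p \<le> c * H q * (ln q - ln p)"
        unfolding H_def using pq x c H0 
        by (intro cdf_increment_le[OF M h]) (auto simp: H_def)
      then show "H q - H p \<le> H q * (c * ln q - c * ln p)"
        by (simp add: algebra_simps)
    qed
    then show ?thesis by (simp add: algebra_simps)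
  next
    case False
    then have yx: "y \<le> x" by simp
    have "c * ln x - c * ln y \<le> ln (H x) - ln (H y)"
    proof (rule ln_increment_ge[OF yx mono pos(2) cont ln_mono[OF y(1)]])
      fix p q assume pq: "y \<le> p" "p \<le> q" "q \<le> x"
      have "c * H p / v \<le> h v" if "p \<le> v" "v \<le> q" for v
      proof -
        have "c * H p / v \<le> c * H v / v"
          using monoD[OF mono that(1)] that pq y c by (intro divide_right_mono mult_left_mono) auto
        also have "\<dots> \<le> h v"
          using that pq y monoD[OF mono, of y v] pos by (intro left) auto
        finally show ?thesis .
      qed
      then have "c * H p * (ln q - ln p) \<le> H q - H p"
        unfolding H_def using pq y c H0 
        by (intro cdf_increment_ge[OF M h]) (auto simp: H_def)
      then show "H p * (c * ln q - c * ln p) \<le> H q - H p"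
        by (simp add: algebra_simps)
    qed
    then show ?thesis by (simp add: algebra_simps)
  qed
  then show ?thesis by (simp add: H_def c_def)
qed



section \<open>Convexity of the inverse generator along a distribution function\<close>

lemma concave_onI_supporting_line:
  fixes f :: "real \<Rightarrow> real"
  assumes S: "convex S"
    and le: "\<And>x y. x \<in> S \<Longrightarrow> y \<in> S \<Longrightarrow> f y \<le> f x + c x * (y - x)"
  shows "concave_on S f"
  unfolding concave_on_def
proof (rule convex_onI[OF _ S])
  fix t x y :: real assume t: "0 < t" "t < 1" and xy: "x \<in> S" "y \<in> S"
  define z where "z = (1 - t) * x + t * y"
  have "z \<in> S"
    unfolding z_def using convexD[OF S xy, of "1 - t" t] t by simp
  then have "(1 - t) * f x + t * f y
      \<le> (1 - t) * (f z + c z * (x - z)) + t * (f z + c z * (y - z))"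
    using t xy by (intro add_mono mult_left_mono le) auto
  also have "\<dots> = f z + c z * ((1 - t) * x + t * y - z)"
    by (simp add: algebra_simps)
  finally show "- f ((1 - t) *\<^sub>R x + t *\<^sub>R y) \<le> (1 - t) * - f x + t * - f y"
    by (simp add: z_def)
qed

text \<open>A positive level is reached before \<open>\<infinity>\<close>, so the inverse can be treated as a real number there.\<close>

lemma gen_inv_finite:
  assumes n: "2 \<le> n" and gen: "generator n \<psi>" and u: "0 < u" "u \<le> 1"
  shows "ennreal (enn2real (gen_inv \<psi> u)) = gen_inv \<psi> u"
proof -
  have "gen_inv \<psi> u \<noteq> \<infinity>"
    using generator_gen_inv[OF n gen, of u] u gen by (auto simp: generator_def)
  then show ?thesis by (simp add: less_top)
qed

text \<open>By \<open>gen_inv_le\<close> it is enough to bound \<open>\<psi>\<close> at the convex combination of the two inverse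
  values. Convexity of \<open>ln \<psi>\<close> bounds its logarithm by the combination of \<open>ln (u x)\<close> and
  \<open>ln (u y)\<close>, and concavity of \<open>ln u\<close> finishes.\<close>

lemma convex_on_gen_inv_comp:
  fixes S :: "real set"
  assumes n: "2 \<le> n" and gen: "generator n \<psi>" and lc: "log_convex \<psi>"
    and u: "\<And>s. s \<in> S \<Longrightarrow> 0 < u s \<and> u s \<le> 1"
    and conc: "concave_on S (\<lambda>s. ln (u s))"
  shows "convex_on S (\<lambda>s. enn2real (gen_inv \<psi> (u s)))"
proof (rule convex_onI)
  show S: "convex S" using conc by (simp add: concave_on_imp_convex)
  define K where "K = (\<lambda>s. enn2real (gen_inv \<psi> (u s)))"
  have K: "\<psi> (ennreal (K s)) = u s" "0 \<le> K s" if "s \<in> S" for s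
    using u[OF that] by (simp_all add: K_def gen_inv_finite[OF n gen] generator_gen_inv[OF n gen])
  fix t x y :: real assume t: "0 < t" "t < 1" and xy: "x \<in> S" "y \<in> S"
  define z where "z = (1 - t) * x + t * y"
  define k where "k = (1 - t) * K x + t * K y"
  have z: "z \<in> S"
    unfolding z_def using convexD[OF S xy, of "1 - t" t] t by simp
  have k: "0 \<le> k" using t K xy by (simp add: k_def)
  have "ln (\<psi> (ennreal k)) \<le> (1 - t) * ln (\<psi> (ennreal (K x))) + t * ln (\<psi> (ennreal (K y)))"
    using lc t K xy convex_onD[of "{0..}" "\<lambda>x. ln (\<psi> (ennreal x))" t "K x" "K y"]
    by (auto simp: log_convex_def k_def)
  also have "\<dots> = (1 - t) * ln (u x) + t * ln (u y)"
    using K xy by simp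
  also have "\<dots> \<le> ln (u z)"
    using concave_onD[OF conc, of t x y] t xy by (simp add: z_def)
  finally have "\<psi> (ennreal k) \<le> u z"
    using lc u[OF z] k by (simp add: log_convex_def)
  then have "gen_inv \<psi> (u z) \<le> ennreal k"
    by (rule gen_inv_le)
  then have "K z \<le> k"
    unfolding K_def using k enn2real_leI by blast
  then show "K ((1 - t) *\<^sub>R x + t *\<^sub>R y) \<le> (1 - t) * K x + t * K y"
    by (simp add: z_def k_def)
qed

section \<open>Decreasing convex functions and weak majorization\<close>

lemma convex_antimono_subgradient:
  fixes K :: "real \<Rightarrow> real"
  assumes S: "open S" and conv: "convex_on S K" and anti: "antimono_on S K"
  obtains c where "\<And>x y. x \<in> S \<Longrightarrow> y \<in> S \<Longrightarrow> K x + c x * (y - x) \<le> K y"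
    and "\<And>x. x \<in> S \<Longrightarrow> c x \<le> 0" and "mono_on S c"
proof -
  define c where "c x = Inf ((\<lambda>t. (K x - K t) / (x - t)) ` ({x<..} \<inter> S))" for x
  have sub: "K x + c x * (y - x) \<le> K y" if "x \<in> S" "y \<in> S" for x y
    unfolding c_def using convex_le_Inf_differential[OF conv] that S by (simp add: interior_open)
  have "c x \<le> 0" if x: "x \<in> S" for x
  proof -
    obtain e where "0 < e" "ball x e \<subseteq> S" using S x by (meson open_contains_ball)
    then have y: "x + e / 2 \<in> S" by (auto simp: dist_real_def subset_eq)
    have "c x * (e / 2) \<le> 0"
      using sub[OF x y] monotone_onD[OF anti x y] \<open>0 < e\<close> by simp
    then show ?thesis using \<open>0 < e\<close> by (simp add: mult_le_0_iff)
  qed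
  moreover have "mono_on S c"
  proof (rule mono_onI)
    fix x y assume xy: "x \<in> S" "y \<in> S" "x \<le> y"
    have "(c x - c y) * (y - x) \<le> 0"
      using sub[OF xy(1,2)] sub[OF xy(2,1)] by (simp add: algebra_simps)
    then show "c x \<le> c y"
      using xy by (cases "x = y") (auto simp: mult_le_0_iff)
  qed
  ultimately show thesis using that sub by blast
qed

text \<open>Abel summation, in the form of a downward induction on \<open>m\<close> which shows that
  \<open>d m * (\<Sum>i=m..n. e i)\<close> is at most \<open>\<Sum>i=m..n. d i * e i\<close>.\<close>

lemma sum_mult_nonneg_if_suffix_sums_nonneg:
  fixes d e :: "nat \<Rightarrow> real"
  assumes n: "1 \<le> n" and d: "mono_on {1..n} d" "0 \<le> d 1"
    and e: "\<And>j. j \<in> {1..n} \<Longrightarrow> 0 \<le> (\<Sum>i=j..n. e i)"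
  shows "0 \<le> (\<Sum>i=1..n. d i * e i)"
proof -
  have "1 \<le> m \<longrightarrow> d m * (\<Sum>i=m..n. e i) \<le> (\<Sum>i=m..n. d i * e i)" if "m \<le> n" for m
    using that
  proof (induction m rule: inc_induct)
    case base
    then show ?case by simp
  next
    case (step m)
    show ?case
    proof
      assume m: "1 \<le> m"
      have "d m * (\<Sum>i=m..n. e i) = d m * e m + d m * (\<Sum>i=Suc m..n. e i)"
        using step by (simp add: sum.atLeast_Suc_atMost algebra_simps)
      also have "\<dots> \<le> d m * e m + d (Suc m) * (\<Sum>i=Suc m..n. e i)"
        using e[of "Suc m"] mono_onD[OF d(1), of m "Suc m"] step m by (intro add_left_mono mult_right_mono) auto
      also have "\<dots> \<le> d m * e m + (\<Sum>i=Suc m..n. d i * e i)"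
        using step by simp
      also have "\<dots> = (\<Sum>i=m..n. d i * e i)"
        using step by (simp add: sum.atLeast_Suc_atMost)
      finally show "d m * (\<Sum>i=m..n. e i) \<le> (\<Sum>i=m..n. d i * e i)" .
    qed
  qed
  from this[of 1] have "d 1 * (\<Sum>i=1..n. e i) \<le> (\<Sum>i=1..n. d i * e i)" using n by simp
  moreover have "0 \<le> d 1 * (\<Sum>i=1..n. e i)" using d e[of 1] n by simp
  ultimately show ?thesis by linarith
qed

text \<open>The heart of the argument. With \<open>a k = ln ((t - \<mu> k) / \<sigma> k)\<close> and \<open>b k\<close> the same with \<open>lam\<close>,
  a subgradient \<open>c \<le> 0\<close> of \<open>K\<close> and \<open>ln x \<le> x - 1\<close> give
  \<open>K (b k) - K (a k) \<ge> c (a k) * (b k - a k) \<ge> d k * (lam k - \<mu> k)\<close> with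
  \<open>d k = - c (a k) / (t - \<mu> k) \<ge> 0\<close>. Since \<open>\<mu>\<close> and \<open>\<sigma>\<close> increase with \<open>k\<close>, the points \<open>a k\<close> and the
  distances \<open>t - \<mu> k\<close> decrease, so the weights \<open>d k\<close> increase, which is what Abel summation needs to
  exploit the nonnegative suffix sums of \<open>lam k - \<mu> k\<close>.\<close>

lemma sum_convex_location_comparison:
  fixes K :: "real \<Rightarrow> real" and n :: nat
  assumes n: "1 \<le> n"
    and S: "open S" "\<And>x y. x \<in> S \<Longrightarrow> x \<le> y \<Longrightarrow> y \<in> S"
    and K: "convex_on S K" "antimono_on S K"
    and \<sigma>: "mono_on {1..n} \<sigma>" "0 < \<sigma> 1" and \<mu>: "mono_on {1..n} \<mu>"
    and t: "\<And>k. k \<in> {1..n} \<Longrightarrow> lam k < t"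
    and suffix: "\<And>j. j \<in> {1..n} \<Longrightarrow> (\<Sum>i=j..n. \<mu> i) \<le> (\<Sum>i=j..n. lam i)"
    and dom: "\<And>k. k \<in> {1..n} \<Longrightarrow> ln ((t - lam k) / \<sigma> k) \<in> S"
  shows "k \<in> {1..n} \<Longrightarrow> ln ((t - \<mu> k) / \<sigma> k) \<in> S"
    and "(\<Sum>k=1..n. K (ln ((t - \<mu> k) / \<sigma> k))) \<le> (\<Sum>k=1..n. K (ln ((t - lam k) / \<sigma> k)))"
proof -
  define a where "a k = ln ((t - \<mu> k) / \<sigma> k)" for k
  define b where "b k = ln ((t - lam k) / \<sigma> k)" for k
  have \<sigma>_pos: "0 < \<sigma> k" if "k \<in> {1..n}" for k
  proof -
    have "\<sigma> 1 \<le> \<sigma> k" using that by (intro mono_onD[OF \<sigma>(1)]) auto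
    then show ?thesis using \<sigma>(2) by linarith
  qed
  have last: "\<mu> n \<le> lam n" using suffix[of n] n by simp
  have \<mu>t: "\<mu> k < t" if "k \<in> {1..n}" for k
    using mono_onD[OF \<mu>, of k n] last t[of n] that n by auto
  have a_anti: "a l \<le> a k" if "k \<in> {1..n}" "l \<in> {1..n}" "k \<le> l" for k l
  proof -
    have "(t - \<mu> l) / \<sigma> l \<le> (t - \<mu> k) / \<sigma> k"
      using that \<sigma>_pos[of k] \<mu>t[of l] mono_onD[OF \<mu>, of k l] mono_onD[OF \<sigma>(1), of k l]
      by (intro frac_le) auto
    then show ?thesis
      unfolding a_def using that \<mu>t[of l] \<sigma>_pos[of l] by (intro ln_mono) auto
  qed
  \<comment> \<open>The smallest of the points \<open>a k\<close> is \<open>a n\<close>, so all of them lie in \<open>S\<close> as soon as \<open>b n\<close> does.\<close>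
  have "b n \<le> a n"
    unfolding a_def b_def using last t[of n] \<sigma>_pos[of n] n by (intro ln_mono divide_right_mono) auto
  moreover have "b n \<in> S" unfolding b_def using dom[of n] n by auto
  ultimately have a_S: "a k \<in> S" if "k \<in> {1..n}" for k
    using S(2) a_anti[of k n] that by auto
  then show "k \<in> {1..n} \<Longrightarrow> ln ((t - \<mu> k) / \<sigma> k) \<in> S" by (simp add: a_def)
  obtain c where sub: "\<And>x y. x \<in> S \<Longrightarrow> y \<in> S \<Longrightarrow> K x + c x * (y - x) \<le> K y"
    and c: "\<And>x. x \<in> S \<Longrightarrow> c x \<le> 0" "mono_on S c"
    using convex_antimono_subgradient[OF S(1) K] by blast
  define d where "d k = - c (a k) / (t - \<mu> k)" for k
  have step: "d k * (lam k - \<mu> k) \<le> K (b k) - K (a k)" if k: "k \<in> {1..n}" for k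
  proof -
    have p: "0 < t - lam k" "0 < t - \<mu> k" "0 < \<sigma> k" using t \<mu>t \<sigma>_pos k by auto
    have "b k - a k = ln ((t - lam k) / (t - \<mu> k))"
      using p by (simp add: a_def b_def ln_div)
    also have "\<dots> \<le> (t - lam k) / (t - \<mu> k) - 1"
      using p by (intro ln_le_minus_one) auto
    also have "\<dots> = - (lam k - \<mu> k) / (t - \<mu> k)"
      using p by (simp add: field_simps)
    finally have "c (a k) * (- (lam k - \<mu> k) / (t - \<mu> k)) \<le> c (a k) * (b k - a k)"
      using c(1)[OF a_S[OF k]] by (rule mult_left_mono_neg)
    moreover have "c (a k) * (- (lam k - \<mu> k) / (t - \<mu> k)) = d k * (lam k - \<mu> k)"
      using p by (simp add: d_def field_simps)
    moreover have "K (a k) + c (a k) * (b k - a k) \<le> K (b k)"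
      using sub[OF a_S[OF k], of "b k"] dom[OF k] by (simp add: b_def)
    ultimately show ?thesis by linarith
  qed
  have "mono_on {1..n} d"
  proof (rule mono_onI)
    fix k l assume kl: "k \<in> {1..n}" "l \<in> {1..n}" "k \<le> l"
    show "d k \<le> d l"
      unfolding d_def
      using mono_onD[OF c(2), of "a l" "a k"] c(1)[of "a k"] c(1)[of "a l"] a_S a_anti \<mu>t[of l] mono_onD[OF \<mu>, of k l] kl
      by (intro frac_le) auto
  qed
  moreover have "0 \<le> d 1"
    using c(1)[OF a_S[of 1]] \<mu>t[of 1] n by (simp add: d_def divide_le_0_iff)
  ultimately have "0 \<le> (\<Sum>k=1..n. d k * (lam k - \<mu> k))"
    using n suffix by (intro sum_mult_nonneg_if_suffix_sums_nonneg) (auto simp: sum_subtractf)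
  also have "\<dots> \<le> (\<Sum>k=1..n. K (b k) - K (a k))"
    by (intro sum_mono step)
  finally show "(\<Sum>k=1..n. K (ln ((t - \<mu> k) / \<sigma> k))) \<le> (\<Sum>k=1..n. K (ln ((t - lam k) / \<sigma> k)))"
    by (simp add: sum_subtractf a_def b_def)
qed

section \<open>Comparing location parameters under one copula and one baseline\<close>

text \<open>The preceding comparison is applied to \<open>K s = gen_inv \<psi> (H (exp s))\<close>, which is decreasing,
  and convex because \<open>\<psi>\<close> is log-convex and \<open>ln (H (exp s))\<close> is concave. It is real-valued only
  where \<open>H (exp s)\<close> is positive.\<close>

lemma copula_location_comparison_increasing:
  assumes n: "2 \<le> n" and gen: "generator n \<psi>" and lc: "log_convex \<psi>"
    and M: "prob_space M" and h: "has_density M U h"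
    and dec: "u_rev_hazard_decreasing h (cdf_of M U)"
    and \<sigma>: "mono_on {1..n} \<sigma>" "0 < \<sigma> 1" and \<mu>: "mono_on {1..n} \<mu>"
    and t: "\<And>k. k \<in> {1..n} \<Longrightarrow> lam k < t"
    and suffix: "\<And>j. j \<in> {1..n} \<Longrightarrow> (\<Sum>i=j..n. \<mu> i) \<le> (\<Sum>i=j..n. lam i)"
  shows "archimedean_copula n \<psi> (\<lambda>k. cdf_of M U ((t - lam k) / \<sigma> k))
    \<le> archimedean_copula n \<psi> (\<lambda>k. cdf_of M U ((t - \<mu> k) / \<sigma> k))"
proof -
  define H where "H = cdf_of M U"
  have U: "U \<in> borel_measurable M"
    using h by (auto simp: has_density_def distributed_def)
  have mono: "mono H" and H: "0 \<le> H u" "H u \<le> 1" for u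
    using cdf_of_bounds[OF M U] by (auto simp: H_def)
  have cont: "isCont H u" for u using isCont_cdf_of[OF M h] by (simp add: H_def)
  have \<sigma>_pos: "0 < \<sigma> k" if "k \<in> {1..n}" for k
  proof -
    have "\<sigma> 1 \<le> \<sigma> k" using that by (intro mono_onD[OF \<sigma>(1)]) auto
    then show ?thesis using \<sigma>(2) by linarith
  qed
  have "\<mu> n \<le> lam n" using suffix[of n] n by simp
  then have \<mu>t: "\<mu> k < t" if "k \<in> {1..n}" for k
    using mono_onD[OF \<mu>, of k n] t[of n] that n by auto
  have \<psi>: "\<And>x. 0 \<le> \<psi> x" "\<psi> \<infinity> = 0" using gen by (auto simp: generator_def)
  show ?thesis
  proof (cases "\<forall>k\<in>{1..n}. 0 < H ((t - lam k) / \<sigma> k)")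
    case False
    then obtain k where k: "k \<in> {1..n}" "H ((t - lam k) / \<sigma> k) = 0"
      using H by (meson antisym not_less)
    \<comment> \<open>A log-convex generator is strict, so one vanishing argument makes the copula vanish.\<close>
    have "gen_inv \<psi> 0 = \<infinity>"
    proof (rule ccontr)
      assume "gen_inv \<psi> 0 \<noteq> \<infinity>"
      then have "ennreal (enn2real (gen_inv \<psi> 0)) = gen_inv \<psi> 0" by (simp add: less_top)
      then have "0 < \<psi> (gen_inv \<psi> 0)"
        using lc by (metis enn2real_nonneg log_convex_def)
      then show False using generator_gen_inv[OF n gen, of 0] by simp
    qed
    then have "(\<Sum>k=1..n. gen_inv \<psi> (H ((t - lam k) / \<sigma> k))) = \<infinity>"
      using k by (auto simp: intro!: bexI[of _ k])
    then have "archimedean_copula n \<psi> (\<lambda>k. H ((t - lam k) / \<sigma> k)) = 0"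
      unfolding archimedean_copula_def using \<psi>(2) by metis
    then show ?thesis
      using \<psi>(1) by (simp add: archimedean_copula_def H_def)
  next
    case True
    define S where "S = {s. 0 < H (exp s)}"
    define K where "K s = enn2real (gen_inv \<psi> (H (exp s)))" for s
    have S_up: "y \<in> S" if "x \<in> S" "x \<le> y" for x y
      using that monoD[OF mono, of "exp x" "exp y"] by (auto simp: S_def)
    have "convex S"
      unfolding is_interval_convex_1[symmetric] is_interval_1 using S_up by blast
    have "continuous_on UNIV (\<lambda>s. H (exp s))"
      using cont by (intro continuous_on_compose2[of UNIV H UNIV exp] continuous_at_imp_continuous_on)
        (auto intro: continuous_intros)
    then have "open S"
      unfolding S_def by (intro open_Collect_less) auto
    have "concave_on S (\<lambda>s. ln (H (exp s)))"
      using ln_cdf_supporting_line[OF M h dec, of "exp _" "exp _"]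
      by (intro concave_onI_supporting_line[OF \<open>convex S\<close>,
            where c = "\<lambda>s. exp s * rev_hazard h H (exp s)"]) (auto simp: S_def H_def)
    then have K_convex: "convex_on S K"
      unfolding K_def using H by (intro convex_on_gen_inv_comp[OF n gen lc]) (auto simp: S_def)
    have \<phi>_K: "gen_inv \<psi> (H (exp s)) = ennreal (K s)" if "s \<in> S" for s
      using that H by (simp add: K_def S_def gen_inv_finite[OF n gen])
    have K_anti: "antimono_on S K"
    proof (rule monotone_onI)
      fix x y assume xy: "x \<in> S" "y \<in> S" "x \<le> y"
      have "ennreal (K y) \<le> ennreal (K x)"
        unfolding \<phi>_K[OF xy(1), symmetric] \<phi>_K[OF xy(2), symmetric]
        using xy by (intro gen_inv_antimono monoD[OF mono]) auto
      then show "K y \<le> K x" by (simp add: K_def)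
    qed
    define a where "a k = ln ((t - \<mu> k) / \<sigma> k)" for k
    define b where "b k = ln ((t - lam k) / \<sigma> k)" for k
    have exp_ab: "exp (a k) = (t - \<mu> k) / \<sigma> k" "exp (b k) = (t - lam k) / \<sigma> k" if "k \<in> {1..n}" for k
      using that t \<mu>t \<sigma>_pos by (auto simp: a_def b_def)
    have b_S: "b k \<in> S" if "k \<in> {1..n}" for k
      using True that exp_ab by (simp add: S_def)
    have "1 \<le> n" using n by simp
    have dom: "ln ((t - lam k) / \<sigma> k) \<in> S" if "k \<in> {1..n}" for k
      using b_S[OF that] by (simp add: b_def)
    have a_S: "a k \<in> S" if "k \<in> {1..n}" for k
      unfolding a_def using S_up t suffix dom that
      by (intro sum_convex_location_comparison(1)[OF \<open>1 \<le> n\<close> \<open>open S\<close> _ K_convex K_anti \<sigma> \<mu>,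
            where lam = lam and t = t]) auto
    have sum_K: "(\<Sum>k=1..n. K (a k)) \<le> (\<Sum>k=1..n. K (b k))"
      unfolding a_def b_def using S_up t suffix dom
      by (intro sum_convex_location_comparison(2)[OF \<open>1 \<le> n\<close> \<open>open S\<close> _ K_convex K_anti \<sigma> \<mu>]) auto
    have "(\<Sum>k=1..n. gen_inv \<psi> (H ((t - \<mu> k) / \<sigma> k))) = ennreal (\<Sum>k=1..n. K (a k))"
      using \<phi>_K[OF a_S] exp_ab by (subst sum_ennreal[symmetric]) (auto simp: K_def intro!: sum.cong)
    also have "\<dots> \<le> ennreal (\<Sum>k=1..n. K (b k))"
      by (rule ennreal_leI[OF sum_K])
    also have "\<dots> = (\<Sum>k=1..n. gen_inv \<psi> (H ((t - lam k) / \<sigma> k)))"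
      using \<phi>_K[OF b_S] exp_ab by (subst sum_ennreal[symmetric]) (auto simp: K_def intro!: sum.cong)
    finally show ?thesis
      unfolding archimedean_copula_def H_def[symmetric]
      by (rule antimonoD[OF generator_antimono[OF n gen]])
  qed
qed

lemma E_plus_increasing_arrangement:
  assumes "x \<in> E_plus n" "i \<in> {1..n}"
  shows "increasing_arrangement n x i = x i"
proof -
  have "sorted (map x [1..<Suc n])"
    using assms(1) by (auto simp: sorted_iff_nth_mono E_plus_def simp del: upt_Suc)
  then show ?thesis
    using assms(2) by (cases i) (simp_all add: increasing_arrangement_def sorted_sort_id del: upt_Suc)
qed

lemma increasing_arrangement_rev:
  "increasing_arrangement n (\<lambda>k. x (n + 1 - k)) = increasing_arrangement n x"
proof -
  have "map (\<lambda>k. x (n + 1 - k)) [1..<Suc n] = rev (map x [1..<Suc n])"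
    by (rule nth_equalityI) (auto simp: rev_nth Suc_diff_Suc simp del: upt_Suc)
  then have "sort (map (\<lambda>k. x (n + 1 - k)) [1..<Suc n]) = sort (map x [1..<Suc n])"
    by (intro properties_for_sort) (simp_all del: upt_Suc)
  then show ?thesis by (simp add: increasing_arrangement_def fun_eq_iff del: upt_Suc)
qed

lemma D_plus_rev:
  assumes "x \<in> D_plus n"
  shows "(\<lambda>k. x (n + 1 - k)) \<in> E_plus n"
proof -
  have "n + 1 - k \<in> {1..n}" if "k \<in> {1..n}" for k using that by auto
  moreover have "x (n + 1 - i) \<le> x (n + 1 - j)" if "i \<in> {1..n}" "j \<in> {1..n}" "i \<le> j" for i j
  proof -
    have "n + 1 - j \<in> {1..n}" "n + 1 - i \<in> {1..n}" "n + 1 - j \<le> n + 1 - i" using that by auto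
    then show ?thesis using assms unfolding D_plus_def by blast
  qed
  ultimately show ?thesis using assms unfolding D_plus_def E_plus_def by blast
qed

text \<open>Reversing the indices turns decreasing vectors into increasing ones and changes neither the
  copula nor the increasing arrangements. For an increasing vector the sums in weak
  submajorization are its suffix sums.\<close>

lemma copula_location_comparison:
  assumes n: "2 \<le> n" and gen: "generator n \<psi>" and lc: "log_convex \<psi>"
    and M: "prob_space M" and h: "has_density M U h"
    and dec: "u_rev_hazard_decreasing h (cdf_of M U)"
    and order: "(lam \<in> D_plus n \<and> \<sigma> \<in> D_plus n \<and> \<mu> \<in> D_plus n) \<or>
                (lam \<in> E_plus n \<and> \<sigma> \<in> E_plus n \<and> \<mu> \<in> E_plus n)"
    and major: "weakly_submajorizes n lam \<mu>"
    and t: "\<And>k. k \<in> {1..n} \<Longrightarrow> lam k < t"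
  shows "archimedean_copula n \<psi> (\<lambda>k. cdf_of M U ((t - lam k) / \<sigma> k))
    \<le> archimedean_copula n \<psi> (\<lambda>k. cdf_of M U ((t - \<mu> k) / \<sigma> k))"
proof -
  have E: "archimedean_copula n \<psi> (\<lambda>k. cdf_of M U ((t - l k) / s k))
      \<le> archimedean_copula n \<psi> (\<lambda>k. cdf_of M U ((t - m k) / s k))"
    if "l \<in> E_plus n" "s \<in> E_plus n" "m \<in> E_plus n" "weakly_submajorizes n l m"
      "\<And>k. k \<in> {1..n} \<Longrightarrow> l k < t" for l m s
  proof (rule copula_location_comparison_increasing[OF n gen lc M h dec])
    show "mono_on {1..n} s" "0 < s 1" "mono_on {1..n} m"
      using that n by (auto simp: E_plus_def mono_on_def)
    show "(\<Sum>i=j..n. m i) \<le> (\<Sum>i=j..n. l i)" if j: "j \<in> {1..n}" for j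
    proof -
      have "(\<Sum>i=j..n. increasing_arrangement n m i) = (\<Sum>i=j..n. m i)"
        "(\<Sum>i=j..n. increasing_arrangement n l i) = (\<Sum>i=j..n. l i)"
        using j \<open>l \<in> E_plus n\<close> \<open>m \<in> E_plus n\<close> by (auto intro!: sum.cong E_plus_increasing_arrangement)
      then show ?thesis
        using \<open>weakly_submajorizes n l m\<close> j unfolding weakly_submajorizes_def by metis
    qed
  qed (use that in auto)
  from order show ?thesis
  proof
    assume "lam \<in> E_plus n \<and> \<sigma> \<in> E_plus n \<and> \<mu> \<in> E_plus n"
    then show ?thesis using E major t by blast
  next
    assume D: "lam \<in> D_plus n \<and> \<sigma> \<in> D_plus n \<and> \<mu> \<in> D_plus n"
    have "weakly_submajorizes n (\<lambda>k. lam (n + 1 - k)) (\<lambda>k. \<mu> (n + 1 - k))"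
      using major by (simp only: weakly_submajorizes_def increasing_arrangement_rev)
    moreover have "lam (n + 1 - k) < t" if "k \<in> {1..n}" for k
      using that by (intro t) auto
    ultimately show ?thesis
      using E[of "\<lambda>k. lam (n + 1 - k)" "\<lambda>k. \<sigma> (n + 1 - k)" "\<lambda>k. \<mu> (n + 1 - k)"] D D_plus_rev
        archimedean_copula_rev[of n \<psi> "\<lambda>k. cdf_of M U ((t - lam k) / \<sigma> k)"]
        archimedean_copula_rev[of n \<psi> "\<lambda>k. cdf_of M U ((t - \<mu> k) / \<sigma> k)"]
      by auto
  qed
qed

text \<open>The last inequality in weak submajorization compares the largest entries, so any \<open>t\<close> beyond
  the locations \<open>lam\<close> is also beyond the locations \<open>\<mu>\<close>.\<close>

lemma weakly_submajorizes_bound: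
  assumes n: "1 \<le> n" and major: "weakly_submajorizes n lam \<mu>"
    and order: "(lam \<in> D_plus n \<and> \<mu> \<in> D_plus n) \<or> (lam \<in> E_plus n \<and> \<mu> \<in> E_plus n)"
    and t: "\<And>k. k \<in> {1..n} \<Longrightarrow> lam k < t" and k: "k \<in> {1..n}"
  shows "\<mu> k < t"
proof -
  have le: "increasing_arrangement n \<mu> n \<le> increasing_arrangement n lam n"
    using bspec[OF major[unfolded weakly_submajorizes_def], of n] n by simp
  from order show ?thesis
  proof
    assume E: "lam \<in> E_plus n \<and> \<mu> \<in> E_plus n"
    then have "\<mu> n \<le> lam n" using le n by (simp add: E_plus_increasing_arrangement)
    moreover have "\<mu> k \<le> \<mu> n" using E k n by (auto simp: E_plus_def)
    ultimately show ?thesis using t[of n] n by simp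
  next
    assume D: "lam \<in> D_plus n \<and> \<mu> \<in> D_plus n"
    then have "\<mu> 1 \<le> lam 1"
      using le n E_plus_increasing_arrangement[OF D_plus_rev[of lam n], of n]
        E_plus_increasing_arrangement[OF D_plus_rev[of \<mu> n], of n]
      by (simp only: increasing_arrangement_rev) simp
    moreover have "\<mu> k \<le> \<mu> 1" using D k n by (auto simp: D_plus_def)
    ultimately show ?thesis using t[of 1] n by simp
  qed
qed

section \<open>Distribution functions of maxima\<close>

lemma max_stat_measurable:
  assumes "1 \<le> n" "\<And>k. k \<in> {1..n} \<Longrightarrow> Z k \<in> borel_measurable M"
  shows "max_stat n Z \<in> borel_measurable M"
  unfolding max_stat_def[abs_def] using assms by (intro borel_measurable_Max) auto

lemma cdf_max_stat:
  assumes n: "1 \<le> n" and Z: "\<And>k. k \<in> {1..n} \<Longrightarrow> Z k \<in> borel_measurable M"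
  shows "cdf_of M (max_stat n Z) t = measure M {\<omega> \<in> space M. \<forall>k\<in>{1..n}. Z k \<omega> \<le> t}"
proof -
  have "max_stat n Z -` {..t} \<inter> space M = {\<omega> \<in> space M. \<forall>k\<in>{1..n}. Z k \<omega> \<le> t}"
    using n by (auto simp: max_stat_def)
  moreover have "max_stat n Z \<in> borel_measurable M"
    by (intro max_stat_measurable n Z)
  ultimately show ?thesis
    by (simp add: cdf_of_def cdf_def measure_distr)
qed

lemma cdf_max_stat_copula:
  assumes n: "1 \<le> n" and cop: "shares_archimedean_copula M n Z \<psi>"
    and LS: "\<forall>i\<in>{1..n}. location_scale M (Z i) (l i) (s i) H"
    and t: "\<And>k. k \<in> {1..n} \<Longrightarrow> l k < t"
  shows "cdf_of M (max_stat n Z) t = archimedean_copula n \<psi> (\<lambda>k. H ((t - l k) / s k))"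
proof -
  have "cdf_of M (max_stat n Z) t = archimedean_copula n \<psi> (\<lambda>k. cdf_of M (Z k) t)"
    using cop LS by (subst cdf_max_stat[OF n]) (auto simp: location_scale_def shares_archimedean_copula_def)
  also have "\<dots> = archimedean_copula n \<psi> (\<lambda>k. H ((t - l k) / s k))"
    unfolding archimedean_copula_def using LS t
    by (intro arg_cong[where f = \<psi>] sum.cong) (auto simp: location_scale_def)
  finally show ?thesis .
qed

text \<open>Right-continuity settles the largest location itself, where the values of the marginal
  distribution functions are not given by the baseline.\<close>

lemma cdf_of_le_if_le_above:
  assumes M: "prob_space M" and U: "U \<in> borel_measurable M"
    and N: "prob_space N" and V: "V \<in> borel_measurable N"
    and le: "\<And>t. a < t \<Longrightarrow> cdf_of M U t \<le> cdf_of N V t"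
  shows "cdf_of M U a \<le> cdf_of N V a"
proof -
  interpret A: real_distribution "distr M borel U"
    using prob_space.real_distribution_distr[OF M U] .
  interpret B: real_distribution "distr N borel V"
    using prob_space.real_distribution_distr[OF N V] .
  have "(cdf_of M U \<longlongrightarrow> cdf_of M U a) (at_right a)" "(cdf_of N V \<longlongrightarrow> cdf_of N V a) (at_right a)"
    using A.cdf_is_right_cont B.cdf_is_right_cont by (auto simp: cdf_of_def continuous_within)
  moreover have "eventually (\<lambda>t. cdf_of M U t \<le> cdf_of N V t) (at_right a)"
    using le by (simp add: eventually_at_filter)
  ultimately show ?thesis
    using tendsto_le trivial_limit_at_right_real by blast
qed

section \<open>Stochastic comparison of the maxima\<close>

theorem theorem18:
  fixes n :: nat
    and PX :: "'a measure" and PY :: "'b measure" and M :: "'c measure" and N :: "'d measure"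
    and X :: "'a \<Rightarrow> real" and Y :: "'b \<Rightarrow> real"
    and Xs :: "nat \<Rightarrow> 'c \<Rightarrow> real" and Ys :: "nat \<Rightarrow> 'd \<Rightarrow> real"
    and F f G g :: "real \<Rightarrow> real"
    and \<psi>\<^sub>1 \<psi>\<^sub>2 :: "ennreal \<Rightarrow> real"
    and lam \<mu> \<sigma> :: "nat \<Rightarrow> real"
  assumes n: "2 \<le> n"
    and PX: "prob_space PX" and PY: "prob_space PY"
    and M: "prob_space M" and N: "prob_space N"
    and F: "F = cdf_of PX X" and f: "has_density PX X f"
    and G: "G = cdf_of PY Y" and g: "has_density PY Y g"
    and gen1: "generator n \<psi>\<^sub>1" and gen2: "generator n \<psi>\<^sub>2"
    and Xs_copula: "shares_archimedean_copula M n Xs \<psi>\<^sub>1"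
    and Xs_LS: "\<forall>i\<in>{1..n}. location_scale M (Xs i) (lam i) (\<sigma> i) F"
    and Ys_copula: "shares_archimedean_copula N n Ys \<psi>\<^sub>2"
    and Ys_LS: "\<forall>i\<in>{1..n}. location_scale N (Ys i) (\<mu> i) (\<sigma> i) G"
    and order: "(lam \<in> D_plus n \<and> \<sigma> \<in> D_plus n \<and> \<mu> \<in> D_plus n) \<or>
                (lam \<in> E_plus n \<and> \<sigma> \<in> E_plus n \<and> \<mu> \<in> E_plus n)"
    and super: "super_additive (gen_inv \<psi>\<^sub>2 \<circ> \<psi>\<^sub>1)"
    and logconv: "log_convex \<psi>\<^sub>1 \<or> log_convex \<psi>\<^sub>2"
    and hazard: "u_rev_hazard_decreasing f F \<or> u_rev_hazard_decreasing g G"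
  shows "st_ge PX X PY Y \<and> weakly_submajorizes n lam \<mu> \<longrightarrow>
         st_ge M (max_stat n Xs) N (max_stat n Ys)"
proof (rule impI, elim conjE)
  assume "st_ge PX X PY Y" and major: "weakly_submajorizes n lam \<mu>"
  then have FG: "F u \<le> G u" for u by (simp add: st_ge_def F G)
  have n1: "1 \<le> n" using n by simp
  have Xm: "X \<in> borel_measurable PX" and Ym: "Y \<in> borel_measurable PY"
    using f g by (auto simp: has_density_def distributed_def)
  have Xs_m: "\<And>k. k \<in> {1..n} \<Longrightarrow> Xs k \<in> borel_measurable M"
    and Ys_m: "\<And>k. k \<in> {1..n} \<Longrightarrow> Ys k \<in> borel_measurable N"
    using Xs_LS Ys_LS by (auto simp: location_scale_def)
  have mX: "max_stat n Xs \<in> borel_measurable M" and mY: "max_stat n Ys \<in> borel_measurable N"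
    by (intro max_stat_measurable n1 Xs_m Ys_m; assumption)+
  have F01: "0 \<le> F u \<and> F u \<le> 1" and G01: "0 \<le> G u \<and> G u \<le> 1" for u
    using cdf_of_bounds[OF PX Xm] cdf_of_bounds[OF PY Ym] by (auto simp: F G)

  have above: "cdf_of M (max_stat n Xs) t \<le> cdf_of N (max_stat n Ys) t"
    if t: "\<And>k. k \<in> {1..n} \<Longrightarrow> lam k < t" for t
  proof -
    define C where "C \<psi> H l = archimedean_copula n \<psi> (\<lambda>k. H ((t - l k) / \<sigma> k))"
      for \<psi> and H :: "real \<Rightarrow> real" and l :: "nat \<Rightarrow> real"
    have location: "C \<psi> H lam \<le> C \<psi> H \<mu>"
      if "generator n \<psi>" "log_convex \<psi>" "(H = F \<and> u_rev_hazard_decreasing f F) \<or> (H = G \<and> u_rev_hazard_decreasing g G)" for \<psi> H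
      unfolding C_def using that(3)
    proof (elim disjE conjE)
      assume "H = F" "u_rev_hazard_decreasing f F"
      then show "archimedean_copula n \<psi> (\<lambda>k. H ((t - lam k) / \<sigma> k))
          \<le> archimedean_copula n \<psi> (\<lambda>k. H ((t - \<mu> k) / \<sigma> k))"
        using copula_location_comparison[OF n that(1,2) PX f _ order major t] by (simp add: F)
    next
      assume "H = G" "u_rev_hazard_decreasing g G"
      then show "archimedean_copula n \<psi> (\<lambda>k. H ((t - lam k) / \<sigma> k))
          \<le> archimedean_copula n \<psi> (\<lambda>k. H ((t - \<mu> k) / \<sigma> k))"
        using copula_location_comparison[OF n that(1,2) PY g _ order major t] by (simp add: G)
    qed
    have baseline: "C \<psi> F l \<le> C \<psi> G l" if "generator n \<psi>" for \<psi> l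
      unfolding C_def by (intro archimedean_copula_mono[OF n that] FG)
    have copula: "C \<psi>\<^sub>1 H l \<le> C \<psi>\<^sub>2 H l" if "H = F \<or> H = G" for H l
      unfolding C_def using that F01 G01
      by (intro archimedean_copula_le_if_super_additive[OF n gen1 gen2 super]) auto
    \<comment> \<open>The three changes can be made in any order; the locations are changed at the stage where the log-convex
      generator and the baseline with decreasing \<open>u * rev_hazard\<close> are both in use.\<close>
    have "C \<psi>\<^sub>1 F lam \<le> C \<psi>\<^sub>2 G \<mu>"
      using logconv hazard
    proof (elim disjE)
      assume "log_convex \<psi>\<^sub>1" "u_rev_hazard_decreasing f F"
      then have "C \<psi>\<^sub>1 F lam \<le> C \<psi>\<^sub>1 F \<mu>" by (intro location gen1) auto
      also have "\<dots> \<le> C \<psi>\<^sub>1 G \<mu>" by (rule baseline[OF gen1])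
      also have "\<dots> \<le> C \<psi>\<^sub>2 G \<mu>" by (rule copula) simp
      finally show ?thesis .
    next
      assume "log_convex \<psi>\<^sub>1" "u_rev_hazard_decreasing g G"
      have "C \<psi>\<^sub>1 F lam \<le> C \<psi>\<^sub>1 G lam" by (rule baseline[OF gen1])
      also have "\<dots> \<le> C \<psi>\<^sub>1 G \<mu>"
        using \<open>log_convex \<psi>\<^sub>1\<close> \<open>u_rev_hazard_decreasing g G\<close> by (intro location gen1) auto
      also have "\<dots> \<le> C \<psi>\<^sub>2 G \<mu>" by (rule copula) simp
      finally show ?thesis .
    next
      assume "log_convex \<psi>\<^sub>2" "u_rev_hazard_decreasing f F"
      have "C \<psi>\<^sub>1 F lam \<le> C \<psi>\<^sub>2 F lam" by (rule copula) simp
      also have "\<dots> \<le> C \<psi>\<^sub>2 F \<mu>"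
        using \<open>log_convex \<psi>\<^sub>2\<close> \<open>u_rev_hazard_decreasing f F\<close> by (intro location gen2) auto
      also have "\<dots> \<le> C \<psi>\<^sub>2 G \<mu>" by (rule baseline[OF gen2])
      finally show ?thesis .
    next
      assume "log_convex \<psi>\<^sub>2" "u_rev_hazard_decreasing g G"
      have "C \<psi>\<^sub>1 F lam \<le> C \<psi>\<^sub>2 F lam" by (rule copula) simp
      also have "\<dots> \<le> C \<psi>\<^sub>2 G lam" by (rule baseline[OF gen2])
      also have "\<dots> \<le> C \<psi>\<^sub>2 G \<mu>"
        using \<open>log_convex \<psi>\<^sub>2\<close> \<open>u_rev_hazard_decreasing g G\<close> by (intro location gen2) auto
      finally show ?thesis .
    qed
    moreover have "\<mu> k < t" if "k \<in> {1..n}" for k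
      using weakly_submajorizes_bound[OF n1 major _ t that] order by blast
    ultimately show ?thesis
      using cdf_max_stat_copula[OF n1 Xs_copula Xs_LS t] cdf_max_stat_copula[OF n1 Ys_copula Ys_LS, of t]
      by (simp add: C_def)
  qed

  define m where "m = Max (lam ` {1..n})"
  have m: "\<And>k. k \<in> {1..n} \<Longrightarrow> lam k \<le> m" by (simp add: m_def)
  have above_m: "cdf_of M (max_stat n Xs) t \<le> cdf_of N (max_stat n Ys) t" if "m < t" for t
  proof (rule above)
    fix k assume "k \<in> {1..n}"
    then show "lam k < t" using m[of k] that by simp
  qed
  have "m \<in> lam ` {1..n}" unfolding m_def using n by (intro Max_in) auto
  then obtain j where j: "j \<in> {1..n}" "m = lam j" by auto
  show "st_ge M (max_stat n Xs) N (max_stat n Ys)"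
    unfolding st_ge_def
  proof
    fix t
    consider "t < m" | "t = m" | "m < t" by linarith
    then show "cdf_of M (max_stat n Xs) t \<le> cdf_of N (max_stat n Ys) t"
    proof cases
      case 1
      \<comment> \<open>Below its largest location the maximum of the \<open>Xs\<close> has no mass.\<close>
      have "cdf_of M (max_stat n Xs) t \<le> cdf_of M (Xs j) t"
      proof -
        interpret prob_space M by (rule M)
        have "{\<omega> \<in> space M. \<forall>k\<in>{1..n}. Xs k \<omega> \<le> t} \<subseteq> Xs j -` {..t} \<inter> space M"
          using j by auto
        then have "cdf_of M (max_stat n Xs) t \<le> measure M (Xs j -` {..t} \<inter> space M)"
          using cdf_max_stat[where Z = Xs and t = t, OF n1] Xs_m measurable_sets[OF Xs_m[OF j(1)], of "{..t}"]
          by (simp add: finite_measure_mono)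
        then show ?thesis
          using Xs_m[OF j(1)] by (simp add: cdf_of_def cdf_def measure_distr)
      qed
      also have "\<dots> = 0" using 1 j Xs_LS by (auto simp: location_scale_def)
      also have "\<dots> \<le> cdf_of N (max_stat n Ys) t" by (rule cdf_of_bounds(1)[OF N mY])
      finally show ?thesis .
    next
      case 2
      show ?thesis
        unfolding 2 by (rule cdf_of_le_if_le_above[OF M mX N mY above_m])
    next
      case 3
      then show ?thesis by (rule above_m)
    qed
  qed
qed

end
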